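(* Let $q$ be a prime power and let $n\ge 2$ be an integer dividing $q^m-1$ for some integer $m\ge 1$. Let $u\ge 0$ be an integer with $u\le\min\{n,q-1\}$. Let $g_0(x)=1+x+x^2+\dots+x^{n-1}\in\mathbb{F}_q[x]$, and let $g_1(x)\in\mathbb{F}_q[x]$ be a monic polynomial of degree $r$, $0\le r<n-1$, that divides $g_0(x)$. Let $\mathcal{C}_1$ be the $[n,n-r,\delta_1]_q$ cyclic code with generator polynomial $g_1(x)$, and let $t\ge 0$ be an integer with $2t+1\le\delta_1$. Then the coding scheme described below is an $(n,M=q^{n-r-1})_q$ $(u,t)$-PSMC for partially-stuck-at-$1$ cells, with redundancy of $1+r$ symbols. Encoder: given a message polynomial $m(x)\in\mathbb{F}_q[x]$ of degree $<n-r-1$ and the set $\boldsymbol{\phi}=\{\phi_0,\dots,\phi_{u-1}\}\subseteq\{0,\dots,n-1\}$ of partially stuck positions, compute $c_1(x)=m(x)g_1(x)$, choose $v\in\mathbb{F}_q$ different from the coefficients of $x^{\phi_0},\dots,x^{\phi_{u-1}}$ in $c_1(x)$ (such a $v$ always exists), put $z_0=-v$, and output (the coefficient vector of) $c(x)=m(x)g_1(x)+z_0g_0(x)$. Decoder: given $y(x)=c(x)+e(x)$, decode $y(x)$ in the code $\mathcal{C}_1$ generated by $g_1(x)$ to the codeword $\hat c(x)$ (unique codeword within Hamming distance $t$), and output $\hat m(x)=\dfrac{\hat c(x)\bmod g_0(x)}{g_1(x)}$.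
   Context: $\mathbb{F}_q$ is the finite field with $q$ elements; its elements are identified with the memory levels $0,1,\dots,q-1$, with the field's zero element corresponding to level $0$. All arithmetic is in $\mathbb{F}_q$. Vectors $(c_0,\dots,c_{n-1})\in\mathbb{F}_q^n$ are identified with polynomials $c_0+c_1x+\dots+c_{n-1}x^{n-1}$, and position $i$ corresponds to the coefficient of $x^i$. The cyclic code of length $n$ with generator polynomial $g(x)\mid x^n-1$ is the set of all multiples of $g(x)$ of degree less than $n$; an $[n,k,\delta]_q$ code is a linear code of length $n$, dimension $k$ and minimum Hamming distance $\delta$ over $\mathbb{F}_q$. A memory cell is partially stuck at level $s$ if it can store only values that are at least $s$; thus a cell partially stuck at level $1$ can store exactly the nonzero elements of $\mathbb{F}_q$. An $(n,M)_q$ $(u,t)$-PSMC (partially-stuck-at-masking code) for partially-stuck-at-$1$ cells is a pair (encoder, decoder) with a message space $\mathcal{M}$ of cardinality $M$. The encoder takes as input any set $\boldsymbol{\phi}=\{\phi_0,\dots,\phi_{u-1}\}\subseteq\{0,\dots,n-1\}$ of $u$ positions (all partially stuck at level $1$) and any message in $\mathcal{M}$, and outputs $\boldsymbol{c}\in\mathbb{F}_q^n$ with $c_{\phi_i}\ge 1$ (i.e. $c_{\phi_i}\ne 0$) for all $i=0,\dots,u-1$. The decoder, which does not know $\boldsymbol{\phi}$, takes as input $\boldsymbol{c}+\boldsymbol{e}$ and returns the correct message for every error vector $\boldsymbol{e}\in\mathbb{F}_q^n$ of Hamming weight at most $t$. The redundancy is $n-\log_q M$. *)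

theory Defs
  imports
    Complex_Main
    "HOL-Library.Cardinality"
    "HOL-Computational_Algebra.Polynomial"
    "Jordan_Normal_Form.VS_Connect"
begin

text \<open>Words of length \<open>n\<close> over a finite field are elements of \<^term>\<open>carrier_vec n\<close>;
  position \<open>i\<close> holds the coefficient of the \<open>i\<close>-th power of the indeterminate.\<close>

definition vec_of_poly :: "nat \<Rightarrow> 'a::zero poly \<Rightarrow> 'a vec" where
  "vec_of_poly n p = vec n (coeff p)"

definition poly_of_vec :: "'a::comm_monoid_add vec \<Rightarrow> 'a poly" where
  "poly_of_vec v = (\<Sum>i<dim_vec v. monom (v $ i) i)"

definition hamming_weight :: "'a::zero vec \<Rightarrow> nat" where
  "hamming_weight v = card {i. i < dim_vec v \<and> v $ i \<noteq> 0}"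

text \<open>Only meaningful for two words of the same length.\<close>

definition hamming_distance :: "'a vec \<Rightarrow> 'a vec \<Rightarrow> nat" where
  "hamming_distance v w = card {i. i < dim_vec v \<and> v $ i \<noteq> w $ i}"

text \<open>Only meaningful for codes with at least two codewords.\<close>

definition min_distance :: "'a vec set \<Rightarrow> nat" where
  "min_distance C = Min {hamming_distance v w | v w. v \<in> C \<and> w \<in> C \<and> v \<noteq> w}"

definition linear_code :: "nat \<Rightarrow> nat \<Rightarrow> nat \<Rightarrow> 'a::field vec set \<Rightarrow> bool" where
  "linear_code n k \<delta> C \<longleftrightarrow>
     VectorSpace.subspace class_ring C (module_vec TYPE('a) n) \<and>
     vectorspace.dim class_ring ((module_vec TYPE('a) n) \<lparr>carrier := C\<rparr>) = k \<and>
     min_distance C = \<delta>"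

text \<open>For \<open>n \<ge> 1\<close> and a generator \<open>g\<close> dividing \<open>x ^ n - 1\<close>. The degree of the zero polynomial is
  \<open>0\<close>, so \<open>degree p < n\<close> admits it exactly when \<open>n \<ge> 1\<close>.\<close>

definition cyclic_code :: "nat \<Rightarrow> 'a::field poly \<Rightarrow> 'a vec set" where
  "cyclic_code n g = {vec_of_poly n p | p. degree p < n \<and> g dvd p}"

text \<open>The function \<open>level\<close> identifies field elements with memory levels.\<close>

definition level_identification :: "('a::{field,finite} \<Rightarrow> nat) \<Rightarrow> bool" where
  "level_identification level \<longleftrightarrow>
     bij_betw level UNIV {0..<CARD('a)} \<and> level 0 = 0"

text \<open>The decoder gets only the received word, not the set \<open>\<phi>\<close> of partially stuck positions.\<close>

definition is_psmc ::
  "('a::{field,finite} \<Rightarrow> nat) \<Rightarrow> nat \<Rightarrow> nat \<Rightarrow> nat \<Rightarrow> nat \<Rightarrow>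
   'm set \<Rightarrow> (nat set \<Rightarrow> 'm \<Rightarrow> 'a vec) \<Rightarrow> ('a vec \<Rightarrow> 'm) \<Rightarrow> bool" where
  "is_psmc level n M u t Msgs enc dec \<longleftrightarrow>
     finite Msgs \<and> card Msgs = M \<and>
     (\<forall>\<phi> m. \<phi> \<subseteq> {0..<n} \<and> card \<phi> = u \<and> m \<in> Msgs \<longrightarrow>
        enc \<phi> m \<in> carrier_vec n \<and>
        (\<forall>i\<in>\<phi>. 1 \<le> level (enc \<phi> m $ i)) \<and>
        (\<forall>e\<in>carrier_vec n. hamming_weight e \<le> t \<longrightarrow> dec (enc \<phi> m + e) = m))"

definition redundancy :: "nat \<Rightarrow> nat \<Rightarrow> nat \<Rightarrow> real" where
  "redundancy q n M = real n - log (real q) (real M)"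

definition all_ones_poly :: "nat \<Rightarrow> 'a::field poly" where
  "all_ones_poly n = (\<Sum>i<n. monom 1 i)"

text \<open>The set of all \<open>m\<close> of degree less than \<open>k\<close>, for \<open>k \<ge> 1\<close>.\<close>

definition message_polys :: "nat \<Rightarrow> 'a::field poly set" where
  "message_polys k = {m. degree m < k}"

text \<open>The field elements the encoder may choose as \<open>v\<close> for the message \<open>m\<close> and the positions \<open>\<phi>\<close>.\<close>

definition admissible_values :: "'a::field poly \<Rightarrow> nat set \<Rightarrow> 'a poly \<Rightarrow> 'a set" where
  "admissible_values g1 \<phi> m = {v. \<forall>i\<in>\<phi>. v \<noteq> coeff (m * g1) i}"

text \<open>The choice of \<open>v\<close> is made by the parameter \<open>pick\<close>.\<close>

definition masking_encoder ::
  "nat \<Rightarrow> 'a::field poly \<Rightarrow> (nat set \<Rightarrow> 'a poly \<Rightarrow> 'a) \<Rightarrow> nat set \<Rightarrow> 'a poly \<Rightarrow> 'a vec" where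
  "masking_encoder n g1 pick \<phi> m =
     (let z0 = - pick \<phi> m
      in vec_of_poly n (m * g1 + Polynomial.smult z0 (all_ones_poly n)))"

definition nearby_codeword :: "'a vec set \<Rightarrow> nat \<Rightarrow> 'a vec \<Rightarrow> 'a vec" where
  "nearby_codeword C t y = (THE c. c \<in> C \<and> hamming_distance c y \<le> t)"

text \<open>The division by \<open>g1\<close> is exact when \<open>g1\<close> divides the all-ones polynomial.\<close>

definition masking_decoder ::
  "nat \<Rightarrow> 'a::field poly \<Rightarrow> nat \<Rightarrow> 'a vec \<Rightarrow> 'a poly" where
  "masking_decoder n g1 t y =
     (poly_of_vec (nearby_codeword (cyclic_code n g1) t y) mod all_ones_poly n) div g1"

end

theory Submission
  imports Defs
begin

text \<open>Since \<open>g1\<close> divides \<open>all_ones_poly n\<close>, adding \<open>z0 * all_ones_poly n\<close> stays in the code generated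
  by \<open>g1\<close>, so the errors can be corrected without knowing the stuck positions. The sum shifts every
  coefficient by \<open>z0\<close>, and as there are fewer than \<open>q\<close> stuck positions some shift makes all of
  their coefficients nonzero. Because \<open>m * g1\<close> has degree below \<open>n - 1\<close>, reducing modulo
  \<open>all_ones_poly n\<close> removes the shift.\<close>

section \<open>Words of length \<open>n\<close> as polynomials of degree below
  \<open>n\<close>\<close>

lemma coeff_poly_of_vec: "coeff (poly_of_vec v) i = (if i < dim_vec v then v $ i else 0)"
  unfolding poly_of_vec_def by (simp add: coeff_sum)

lemma degree_poly_of_vec_less:
  assumes "0 < dim_vec v"
  shows "degree (poly_of_vec v) < dim_vec v"
proof -
  have "degree (poly_of_vec v) \<le> dim_vec v - 1"
    by (rule degree_le) (auto simp: coeff_poly_of_vec)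
  with assms show ?thesis by simp
qed

lemma vec_of_poly_carrier [simp]: "vec_of_poly n p \<in> carrier_vec n"
  by (simp add: vec_of_poly_def)

lemma poly_of_vec_vec_of_poly:
  assumes "degree p < n"
  shows "poly_of_vec (vec_of_poly n p) = p"
  using assms by (auto simp: poly_eq_iff coeff_poly_of_vec vec_of_poly_def coeff_eq_0)

lemma vec_of_poly_poly_of_vec:
  assumes "v \<in> carrier_vec n"
  shows "vec_of_poly n (poly_of_vec v) = v"
  using assms by (auto simp: coeff_poly_of_vec vec_of_poly_def)

text \<open>Used twice: to count the messages, and to let a vector space stand for the polynomials
  of bounded degree that are multiplied by the generator. Positivity of \<open>n\<close> matters
  because the zero polynomial has degree 0, so for \<open>n = 0\<close> the empty word would be sent
  outside the right-hand set.\<close>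

lemma bij_betw_poly_of_vec:
  assumes "0 < n"
  shows "bij_betw poly_of_vec (carrier_vec n) {p :: 'a::comm_monoid_add poly. degree p < n}"
proof (rule bij_betwI[where g = "vec_of_poly n"])
  show "poly_of_vec \<in> carrier_vec n \<rightarrow> {p :: 'a poly. degree p < n}"
  proof (intro funcsetI CollectI)
    fix v :: "'a vec"
    assume "v \<in> carrier_vec n"
    then show "degree (poly_of_vec v) < n"
      using degree_poly_of_vec_less[of v] assms by auto
  qed
qed (auto simp: poly_of_vec_vec_of_poly vec_of_poly_poly_of_vec)

lemma card_carrier_vec: "card (carrier_vec n :: 'a::finite vec set) = CARD('a) ^ n"
proof -
  have "bij_betw list_of_vec (carrier_vec n) {xs :: 'a list. set xs \<subseteq> UNIV \<and> length xs = n}"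
  proof (rule bij_betwI[where g = vec_of_list])
    show "vec_of_list \<in> {xs :: 'a list. set xs \<subseteq> UNIV \<and> length xs = n} \<rightarrow> carrier_vec n"
      by (auto intro: carrier_vecI)
  qed (auto simp: list_vec vec_list)
  from bij_betw_same_card[OF this] show ?thesis
    using card_lists_length_eq[of "UNIV :: 'a set" n] by simp
qed

lemma card_message_polys:
  assumes "0 < k"
  shows "card (message_polys k :: 'a::{field,finite} poly set) = CARD('a) ^ k"
  using bij_betw_same_card[OF bij_betw_poly_of_vec[OF assms, where 'a = 'a]]
  by (simp add: message_polys_def card_carrier_vec)

section \<open>The all-ones polynomial and the available shifts\<close>

lemma coeff_all_ones_poly: "coeff (all_ones_poly n) i = (if i < n then 1 else 0)"
  unfolding all_ones_poly_def by (simp add: coeff_sum)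

lemma degree_all_ones_poly: "degree (all_ones_poly n :: 'a::field poly) = n - 1"
proof (cases n)
  case 0
  then show ?thesis by (simp add: all_ones_poly_def)
next
  case (Suc k)
  show ?thesis
  proof (rule antisym)
    show "degree (all_ones_poly n :: 'a poly) \<le> n - 1"
      by (rule degree_le) (auto simp: coeff_all_ones_poly)
    show "n - 1 \<le> degree (all_ones_poly n :: 'a poly)"
      by (rule le_degree) (simp add: coeff_all_ones_poly Suc)
  qed
qed

text \<open>Pigeonhole: the forbidden values are the coefficients at the positions in
  \<open>\<phi>\<close>, too few to exhaust the field.\<close>

lemma admissible_values_nonempty:
  fixes g1 :: "'a::{field,finite} poly"
  assumes "finite \<phi>" "card \<phi> < CARD('a)"
  shows "admissible_values g1 \<phi> m \<noteq> {}"
proof -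
  have "card (coeff (m * g1) ` \<phi>) < CARD('a)"
    using assms card_image_le le_less_trans by blast
  then have "coeff (m * g1) ` \<phi> \<noteq> UNIV" by auto
  then obtain v where "v \<notin> coeff (m * g1) ` \<phi>" by blast
  then have "v \<in> admissible_values g1 \<phi> m"
    by (auto simp: admissible_values_def)
  then show ?thesis by blast
qed

section \<open>Hamming distance and unique decoding\<close>

lemma hamming_distance_triangle:
  assumes "dim_vec v = dim_vec w"
  shows "hamming_distance v w \<le> hamming_distance v y + hamming_distance w y"
proof -
  let ?D = "\<lambda>v w. {i. i < dim_vec v \<and> v $ i \<noteq> w $ i}"
  \<comment> \<open>Where \<open>v\<close> and \<open>w\<close> differ, at least one of them differs
    from \<open>y\<close>.\<close>
  have "card (?D v w) \<le> card (?D v y \<union> ?D w y)"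
    by (rule card_mono) (use assms in auto)
  also have "\<dots> \<le> card (?D v y) + card (?D w y)"
    by (rule card_Un_le)
  finally show ?thesis
    by (simp add: hamming_distance_def)
qed

lemma hamming_distance_add_right:
  fixes c e :: "'a::ab_group_add vec"
  assumes "c \<in> carrier_vec n" "e \<in> carrier_vec n"
  shows "hamming_distance c (c + e) = hamming_weight e"
  unfolding hamming_distance_def hamming_weight_def
  using assms by (intro arg_cong[where f = card]) auto

lemma min_distance_le:
  assumes "C \<subseteq> carrier_vec n" "v \<in> C" "w \<in> C" "v \<noteq> w"
  shows "min_distance C \<le> hamming_distance v w"
proof -
  have "hamming_distance v w \<le> n" if "v \<in> C" for v w
  proof -
    have "hamming_distance v w \<le> card {..<n}"
      unfolding hamming_distance_def using that assms(1) by (intro card_mono) auto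
    then show ?thesis by simp
  qed
  \<comment> \<open>The bound by \<open>n\<close> makes the set of distances finite, as
    \<open>Min\<close> requires, even over an infinite alphabet.\<close>
  then have "{hamming_distance v w | v w. v \<in> C \<and> w \<in> C \<and> v \<noteq> w} \<subseteq> {..n}"
    by auto
  then have "finite {hamming_distance v w | v w. v \<in> C \<and> w \<in> C \<and> v \<noteq> w}"
    using finite_subset by blast
  then show ?thesis
    unfolding min_distance_def by (rule Min_le) (use assms in blast)
qed

text \<open>Two codewords within \<open>t\<close> of the same word are at most \<open>2 * t\<close>
  apart, which is below the minimum distance. In the form of an equivalence it rewrites both the
  definite description in \<open>nearby_codeword\<close> and the unique existence claim of the
  theorem.\<close>

lemma bounded_distance_decoding:
  fixes C :: "'a::ab_group_add vec set"
  assumes "C \<subseteq> carrier_vec n" "2 * t + 1 \<le> min_distance C"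
    and "c \<in> C" "e \<in> carrier_vec n" "hamming_weight e \<le> t"
  shows "c' \<in> C \<and> hamming_distance c' (c + e) \<le> t \<longleftrightarrow> c' = c"
proof
  have near: "hamming_distance c (c + e) \<le> t"
    using assms hamming_distance_add_right[of c n e] by auto
  then show "c' \<in> C \<and> hamming_distance c' (c + e) \<le> t" if "c' = c"
    using that assms(3) by simp
  assume c': "c' \<in> C \<and> hamming_distance c' (c + e) \<le> t"
  show "c' = c"
  proof (rule ccontr)
    assume "c' \<noteq> c"
    then have "min_distance C \<le> hamming_distance c' c"
      using assms c' by (intro min_distance_le) auto
    also have "\<dots> \<le> hamming_distance c' (c + e) + hamming_distance c (c + e)"
      using assms(1,3) c' by (intro hamming_distance_triangle) (metis carrier_vecD subsetD)
    finally show False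
      using near c' assms(2) by linarith
  qed
qed

lemma nearby_codeword_add:
  fixes C :: "'a::ab_group_add vec set"
  assumes "C \<subseteq> carrier_vec n" "2 * t + 1 \<le> min_distance C"
    and "c \<in> C" "e \<in> carrier_vec n" "hamming_weight e \<le> t"
  shows "nearby_codeword C t (c + e) = c"
  unfolding nearby_codeword_def bounded_distance_decoding[OF assms] by simp

section \<open>Cyclic codes as images of a linear map, and their dimension\<close>

lemma cyclic_code_carrier: "cyclic_code n g \<subseteq> carrier_vec n"
  by (auto simp: cyclic_code_def)

lemma degree_mult_less:
  fixes p g :: "'a::field poly"
  assumes "degree p < k" "k + degree g \<le> n"
  shows "degree (p * g) < n"
  using degree_mult_le[of p g] assms by linarith

text \<open>Presents the code as the image of multiplication by \<open>g\<close> on a space of known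
  dimension, which prepares the use of rank-nullity.\<close>

lemma cyclic_code_eq_image:
  fixes g :: "'a::field poly"
  assumes "degree g < n" "g \<noteq> 0"
  shows "cyclic_code n g = (\<lambda>v. vec_of_poly n (poly_of_vec v * g)) ` carrier_vec (n - degree g)"
proof -
  have "cyclic_code n g = (\<lambda>p. vec_of_poly n (p * g)) ` {p. degree p < n - degree g}"
  proof (intro equalityI subsetI)
    fix c
    assume "c \<in> cyclic_code n g"
    then obtain p where p: "c = vec_of_poly n p" "degree p < n" "g dvd p"
      by (auto simp: cyclic_code_def)
    from p(3) obtain m where m: "p = m * g"
      by (auto simp: dvd_def mult.commute)
    \<comment> \<open>Degrees add only for nonzero factors; for \<open>m = 0\<close> the claim is
      \<open>degree g < n\<close>.\<close>
    have "degree m < n - degree g"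
      using p(2) assms by (cases "m = 0") (auto simp: m degree_mult_eq)
    with p(1) m show "c \<in> (\<lambda>p. vec_of_poly n (p * g)) ` {p. degree p < n - degree g}"
      by blast
  next
    fix c
    assume "c \<in> (\<lambda>p. vec_of_poly n (p * g)) ` {p. degree p < n - degree g}"
    then show "c \<in> cyclic_code n g"
      using assms(1) degree_mult_less[of _ "n - degree g" g n] by (fastforce simp: cyclic_code_def)
  qed
  also have "{p :: 'a poly. degree p < n - degree g} = poly_of_vec ` carrier_vec (n - degree g)"
    using bij_betw_poly_of_vec[of "n - degree g", where 'a = 'a] assms(1) by (simp add: bij_betw_def)
  finally show ?thesis
    by (simp add: image_image)
qed

lemma poly_of_vec_add:
  assumes "v \<in> carrier_vec n" "w \<in> carrier_vec n"
  shows "poly_of_vec (v + w) = poly_of_vec v + poly_of_vec w"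
  using assms by (auto simp: poly_eq_iff coeff_poly_of_vec)

lemma poly_of_vec_smult:
  fixes v :: "'a::field vec"
  shows "poly_of_vec (a \<cdot>\<^sub>v v) = Polynomial.smult a (poly_of_vec v)"
  by (auto simp: poly_eq_iff coeff_poly_of_vec)

lemma linear_map_encode:
  fixes g :: "'a::field poly"
  shows "linear_map class_ring (module_vec TYPE('a) k) (module_vec TYPE('a) n)
    (\<lambda>v. vec_of_poly n (poly_of_vec v * g))"
proof -
  let ?T = "\<lambda>v :: 'a vec. vec_of_poly n (poly_of_vec v * g)"
  have "?T \<in> LinearCombinations.module_hom class_ring (module_vec TYPE('a) k) (module_vec TYPE('a) n)"
    by (auto simp: LinearCombinations.module_hom_def module_vec_simps class_ring_simps poly_of_vec_add
        poly_of_vec_smult vec_of_poly_def algebra_simps)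
  then have "mod_hom class_ring (module_vec TYPE('a) k) (module_vec TYPE('a) n) ?T"
    by (simp add: mod_hom_def mod_hom_axioms_def vec_module)
  then show ?thesis
    by (simp add: linear_map_def vec_vs)
qed

text \<open>Rank-nullity for the encoding map: it is injective, so its image has the dimension of
  its domain.\<close>

lemma linear_code_cyclic_code:
  fixes g :: "'a::field poly"
  assumes "degree g < n" "g \<noteq> 0"
  shows "linear_code n (n - degree g) (min_distance (cyclic_code n g)) (cyclic_code n g)"
proof -
  let ?k = "n - degree g"
  let ?V = "module_vec TYPE('a) ?k"
  let ?W = "module_vec TYPE('a) n"
  let ?T = "\<lambda>v :: 'a vec. vec_of_poly n (poly_of_vec v * g)"
  interpret linear_map class_ring ?V ?W ?T
    by (rule linear_map_encode)
  interpret V: vec_space "TYPE('a)" ?k .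
  have im: "imT = cyclic_code n g"
    unfolding cyclic_code_eq_image[OF assms] im_def by (simp add: module_vec_simps)
  \<comment> \<open>The products have degree below \<open>n\<close>, so cutting them to
    \<open>n\<close> coefficients loses nothing, and then the nonzero factor \<open>g\<close>
    cancels.\<close>
  have "inj_on ?T (carrier_vec ?k)"
  proof (rule inj_onI)
    fix v w :: "'a vec"
    assume v: "v \<in> carrier_vec ?k" and w: "w \<in> carrier_vec ?k" and eq: "?T v = ?T w"
    have "degree (poly_of_vec x * g) < n" if "x \<in> carrier_vec ?k" for x
      using degree_poly_of_vec_less[of x] that assms(1) by (intro degree_mult_less[of _ ?k]) auto
    then have "poly_of_vec v * g = poly_of_vec w * g"
      using poly_of_vec_vec_of_poly eq v w by metis
    then have "poly_of_vec v = poly_of_vec w"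
      using assms(2) by simp
    then show "v = w"
      using vec_of_poly_poly_of_vec v w by metis
  qed
  then have "vectorspace.dim class_ring (?V\<lparr>carrier := kerT\<rparr>) = 0"
    by (intro inj_imp_dim_ker0) (simp add: module_vec_simps)
  then have "vectorspace.dim class_ring (?W\<lparr>carrier := cyclic_code n g\<rparr>) = ?k"
    using rank_nullity_main(1)[OF V.fin_dim] V.dim_is_n by (simp add: im)
  moreover have "VectorSpace.subspace class_ring (cyclic_code n g) ?W"
    using imT_is_subspace by (simp add: im)
  ultimately show ?thesis
    by (simp add: linear_code_def)
qed

section \<open>Correctness of the masking encoder and decoder\<close>

lemma masking_encoder_in_cyclic_code:
  assumes "g1 dvd all_ones_poly n" "degree g1 < n - 1" "m \<in> message_polys (n - degree g1 - 1)"
  shows "masking_encoder n g1 pick \<phi> m \<in> cyclic_code n g1"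
    and "poly_of_vec (masking_encoder n g1 pick \<phi> m) mod all_ones_poly n = m * g1"
proof -
  let ?c = "m * g1 + Polynomial.smult (- pick \<phi> m) (all_ones_poly n)"
  \<comment> \<open>The bound is \<open>n - 1\<close> rather than \<open>n\<close>, because
    \<open>n - 1\<close> is the degree of the all-ones polynomial: the product is then its own
    remainder.\<close>
  have deg: "degree (m * g1) < n - 1"
    using assms by (intro degree_mult_less[of _ "n - degree g1 - 1"]) (auto simp: message_polys_def)
  then have deg_c: "degree ?c < n"
    using assms(2) by (intro degree_add_less) (auto simp: degree_all_ones_poly)
  have enc: "masking_encoder n g1 pick \<phi> m = vec_of_poly n ?c"
    by (simp add: masking_encoder_def Let_def)
  have "g1 dvd ?c"
    using assms(1) by (intro dvd_add dvd_smult) auto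
  with deg_c show "masking_encoder n g1 pick \<phi> m \<in> cyclic_code n g1"
    unfolding enc cyclic_code_def by blast
  \<comment> \<open>The scalar is read as a constant polynomial, which makes the shift a multiple of
    the modulus.\<close>
  have "?c mod all_ones_poly n = m * g1 mod all_ones_poly n"
    using mod_mult_self1[of "m * g1" "[:- pick \<phi> m:]" "all_ones_poly n"] by simp
  also have "\<dots> = m * g1"
    using deg by (intro mod_poly_less) (simp add: degree_all_ones_poly)
  finally show "poly_of_vec (masking_encoder n g1 pick \<phi> m) mod all_ones_poly n = m * g1"
    unfolding enc poly_of_vec_vec_of_poly[OF deg_c] .
qed

text \<open>Every coefficient of the all-ones polynomial below \<open>n\<close> is 1, so entry
  \<open>i\<close> is \<open>coeff (m * g1) i - pick \<phi> m\<close>, a difference of distinct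
  elements.\<close>

lemma masking_encoder_nonzero:
  assumes "i \<in> \<phi>" "i < n" "pick \<phi> m \<in> admissible_values g1 \<phi> m"
  shows "masking_encoder n g1 pick \<phi> m $ i \<noteq> 0"
  using assms
  by (auto simp: masking_encoder_def vec_of_poly_def coeff_all_ones_poly admissible_values_def)

text \<open>Error correction returns the encoder output, reduction leaves \<open>m * g1\<close>, and
  division by \<open>g1\<close> is exact.\<close>

lemma masking_decoder_correct:
  fixes g1 :: "'a::field poly"
  assumes "g1 dvd all_ones_poly n" "degree g1 < n - 1" "m \<in> message_polys (n - degree g1 - 1)"
    and "g1 \<noteq> 0" "2 * t + 1 \<le> min_distance (cyclic_code n g1)"
    and "e \<in> carrier_vec n" "hamming_weight e \<le> t"
  shows "masking_decoder n g1 t (masking_encoder n g1 pick \<phi> m + e) = m"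
  using assms masking_encoder_in_cyclic_code[OF assms(1-3), of pick \<phi>]
  by (simp add: masking_decoder_def nearby_codeword_add[OF cyclic_code_carrier])

section \<open>Redundancy and assembly of the scheme\<close>

lemma redundancy_power:
  assumes "1 < q" "k \<le> n"
  shows "redundancy q n (q ^ k) = real (n - k)"
  using assms by (simp add: redundancy_def log_nat_power of_nat_diff)

theorem theorem2:
  fixes level :: "'a::{field,finite} \<Rightarrow> nat"
    and g1 :: "'a poly"
    and C1 :: "'a vec set"
    and q n u r t \<delta>1 :: nat
  assumes "q = CARD('a)"
    and "level_identification level"
    and "n \<ge> 2"
    and "\<exists>m\<ge>1. n dvd q ^ m - 1"
    and "u \<le> min n (q - 1)"
    and "lead_coeff g1 = 1"
    and "degree g1 = r"
    and "r < n - 1"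
    and "g1 dvd all_ones_poly n"
    and "C1 = cyclic_code n g1"
    and "\<delta>1 = min_distance C1"
    and "2 * t + 1 \<le> \<delta>1"
  shows
    "linear_code n (n - r) \<delta>1 C1 \<and>
     (\<forall>\<phi> m. \<phi> \<subseteq> {0..<n} \<and> card \<phi> = u \<and> m \<in> message_polys (n - r - 1) \<longrightarrow>
        admissible_values g1 \<phi> m \<noteq> {}) \<and>
     (\<forall>pick.
        (\<forall>\<phi> m. \<phi> \<subseteq> {0..<n} \<and> card \<phi> = u \<and> m \<in> message_polys (n - r - 1) \<longrightarrow>
           pick \<phi> m \<in> admissible_values g1 \<phi> m) \<longrightarrow>
        (\<forall>\<phi> m e. \<phi> \<subseteq> {0..<n} \<and> card \<phi> = u \<and> m \<in> message_polys (n - r - 1) \<and>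
             e \<in> carrier_vec n \<and> hamming_weight e \<le> t \<longrightarrow>
           (\<exists>!c. c \<in> C1 \<and> hamming_distance c (masking_encoder n g1 pick \<phi> m + e) \<le> t)) \<and>
        is_psmc level n (q ^ (n - r - 1)) u t (message_polys (n - r - 1))
          (masking_encoder n g1 pick) (masking_decoder n g1 t)) \<and>
     redundancy q n (q ^ (n - r - 1)) = 1 + real r"
proof (intro conjI allI impI)
  have g1: "g1 \<noteq> 0" "degree g1 < n" "degree g1 < n - 1"
    using assms by auto
  \<comment> \<open>A field contains the distinct elements 0 and 1.\<close>
  have q: "1 < q"
    using card_mono[of UNIV "{0, 1 :: 'a}"] assms(1) by simp
  have dist: "2 * t + 1 \<le> min_distance (cyclic_code n g1)"
    using assms by simp
  show "linear_code n (n - r) \<delta>1 C1"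
    using linear_code_cyclic_code[OF g1(2,1)] assms by simp
  show "redundancy q n (q ^ (n - r - 1)) = 1 + real r"
    using redundancy_power[OF q, of "n - r - 1" n] \<open>r < n - 1\<close> by simp
  \<comment> \<open>From \<open>u \<le> q - 1\<close> and \<open>q > 0\<close> the number of stuck
    positions is strictly below \<open>q\<close>.\<close>
  show "admissible_values g1 \<phi> m \<noteq> {}"
    if "\<phi> \<subseteq> {0..<n} \<and> card \<phi> = u \<and> m \<in> message_polys (n - r - 1)" for \<phi> m
    using that assms(1,5) q by (intro admissible_values_nonempty) (auto dest: finite_subset)
  fix pick
  assume pick: "\<forall>\<phi> m. \<phi> \<subseteq> {0..<n} \<and> card \<phi> = u \<and> m \<in> message_polys (n - r - 1) \<longrightarrow>
    pick \<phi> m \<in> admissible_values g1 \<phi> m"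
  show "\<exists>!c. c \<in> C1 \<and> hamming_distance c (masking_encoder n g1 pick \<phi> m + e) \<le> t"
    if "\<phi> \<subseteq> {0..<n} \<and> card \<phi> = u \<and> m \<in> message_polys (n - r - 1) \<and>
      e \<in> carrier_vec n \<and> hamming_weight e \<le> t" for \<phi> m e
  proof -
    have "masking_encoder n g1 pick \<phi> m \<in> cyclic_code n g1"
      using that assms g1 by (intro masking_encoder_in_cyclic_code) auto
    then show ?thesis
      using that \<open>C1 = cyclic_code n g1\<close>
      by (simp add: bounded_distance_decoding[OF cyclic_code_carrier dist])
  qed
  show "is_psmc level n (q ^ (n - r - 1)) u t (message_polys (n - r - 1))
    (masking_encoder n g1 pick) (masking_decoder n g1 t)"
    unfolding is_psmc_def
  proof (intro conjI allI impI ballI)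
    show card: "card (message_polys (n - r - 1) :: 'a poly set) = q ^ (n - r - 1)"
      using card_message_polys[of "n - r - 1", where 'a = 'a] assms(1) \<open>r < n - 1\<close> by simp
    \<comment> \<open>An infinite set has cardinality 0, so the positive cardinality just shown
      gives finiteness.\<close>
    show "finite (message_polys (n - r - 1) :: 'a poly set)"
      using card q by (intro card_ge_0_finite) simp
  next
    fix \<phi> and m :: "'a poly"
    assume \<phi>m: "\<phi> \<subseteq> {0..<n} \<and> card \<phi> = u \<and> m \<in> message_polys (n - r - 1)"
    show "masking_encoder n g1 pick \<phi> m \<in> carrier_vec n"
      by (simp add: masking_encoder_def Let_def)
    show "1 \<le> level (masking_encoder n g1 pick \<phi> m $ i)" if "i \<in> \<phi>" for i
    proof -
      \<comment> \<open>By injectivity only the zero element has level 0, so a nonzero entry has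
        level at least 1.\<close>
      have "inj level" "level 0 = 0"
        using assms(2) by (auto simp: level_identification_def bij_betw_def)
      moreover have "masking_encoder n g1 pick \<phi> m $ i \<noteq> 0"
        using that \<phi>m pick by (intro masking_encoder_nonzero) auto
      ultimately have "level (masking_encoder n g1 pick \<phi> m $ i) \<noteq> 0"
        by (metis injD)
      then show ?thesis by simp
    qed
    show "masking_decoder n g1 t (masking_encoder n g1 pick \<phi> m + e) = m"
      if "e \<in> carrier_vec n" "hamming_weight e \<le> t" for e
      using that \<phi>m assms g1 dist by (intro masking_decoder_correct) auto
  qed
qed

end
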